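(* Let $A$ be an algebraic CPO with basis $B$, $C$ a CPO, and $f:B\to C$ monotone. Then $\overline f:A\to C$ is continuous.
   Context: An ordered type is a type with a reflexive transitive relation $\sqsubseteq$. $U:\mathbb{N}\to X$ is directed if $\forall i\,j\,\exists k,\ U\,i\sqsubseteq U\,k\land U\,j\sqsubseteq U\,k$; an $\omega$-chain if $i\le j\Rightarrow U\,i\sqsubseteq U\,j$. A CPO (dCPO) is an ordered type in which every directed $U:\mathbb{N}\to X$ has a supremum; an $\omega$-CPO one in which every $\omega$-chain has a supremum. $h:X\to Y$ is monotone if $x\sqsubseteq y\Rightarrow h\,x\sqsubseteq h\,y$, and continuous if $h(\sup U)=\sup(h\circ U)$ for every directed $U$. $x$ is compact if for every directed $U$ with $\sup U=x$ there is $i$ with $U\,i=x$; a type is compact if all its elements are. For an $\omega$-CPO $A$ and ordered type $B$, $B$ is dense in $A$ if there are continuous $\mathsf{incl}:B\to A$ and $\mathsf{idl}:A\to\mathbb{N}\to B$ with $\mathsf{idl}\,a$ an $\omega$-chain and $\sup(\mathsf{incl}\circ\mathsf{idl}\,a)=a$ for all $a$. $A$ is an algebraic CPO with basis $B$ if $B$ is compact and dense in $A$. For monotone $f:B\to C$, $\overline f(a):=\sup_i f(\mathsf{idl}\,a\,i)$ (supremum chosen by choice). *)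

theory Defs
  imports Main
begin

text \<open>
  Ordered types carry a mere preorder, so suprema are unique only up to order-equivalence.
  Accordingly ``\<open>sup U = s\<close>'' is rendered by the relation \<open>is_sup U s\<close>.
\<close>

context preorder
begin

definition directed :: "(nat \<Rightarrow> 'a) \<Rightarrow> bool" where
  "directed U \<longleftrightarrow> (\<forall>i j. \<exists>k. U i \<le> U k \<and> U j \<le> U k)"

definition omega_chain :: "(nat \<Rightarrow> 'a) \<Rightarrow> bool" where
  "omega_chain U \<longleftrightarrow> (\<forall>i j. i \<le> j \<longrightarrow> U i \<le> U j)"

definition is_sup :: "(nat \<Rightarrow> 'a) \<Rightarrow> 'a \<Rightarrow> bool" where
  "is_sup U s \<longleftrightarrow> (\<forall>i. U i \<le> s) \<and> (\<forall>u. (\<forall>i. U i \<le> u) \<longrightarrow> s \<le> u)"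

definition order_equiv :: "'a \<Rightarrow> 'a \<Rightarrow> bool" where
  "order_equiv x y \<longleftrightarrow> x \<le> y \<and> y \<le> x"

text \<open>
  The sequence attains its supremum up to order-equivalence. Literal equality \<open>U i = x\<close> is a
  stronger demand: applied to constant sequences it would force a type all of whose elements are
  compact to be antisymmetric. For partial orders the two coincide.
\<close>

definition compact_elem :: "'a \<Rightarrow> bool" where
  "compact_elem x \<longleftrightarrow> (\<forall>U. directed U \<and> is_sup U x \<longrightarrow> (\<exists>i. order_equiv (U i) x))"

end

class dcpo = preorder +
  assumes directed_has_sup: "directed U \<Longrightarrow> \<exists>s. is_sup U s"

class omega_cpo = preorder +
  assumes omega_chain_has_sup: "omega_chain U \<Longrightarrow> \<exists>s. is_sup U s"

text \<open>
  The domain need not be complete: the condition concerns every directed sequence that has a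
  supremum.
\<close>

definition continuous :: "('a::preorder \<Rightarrow> 'b::preorder) \<Rightarrow> bool" where
  "continuous h \<longleftrightarrow> (\<forall>U s. directed U \<and> is_sup U s \<longrightarrow> is_sup (h \<circ> U) (h s))"

definition compact_type :: "'b::preorder itself \<Rightarrow> bool" where
  "compact_type _ \<longleftrightarrow> (\<forall>x::'b. compact_elem x)"

text \<open>Continuity of \<open>idl\<close> refers to the pointwise order on \<open>nat \<Rightarrow> 'b\<close>.\<close>

definition dense_via :: "('b::preorder \<Rightarrow> 'a::omega_cpo) \<Rightarrow> ('a \<Rightarrow> nat \<Rightarrow> 'b) \<Rightarrow> bool" where
  "dense_via incl idl \<longleftrightarrow>
     continuous incl \<and> continuous idl \<and>
     (\<forall>a. omega_chain (idl a)) \<and> (\<forall>a. is_sup (incl \<circ> idl a) a)"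

text \<open>
  The witnesses \<open>incl\<close> and \<open>idl\<close> of density are explicit parameters, because the extension of a
  monotone map is defined in terms of \<open>idl\<close>.
\<close>

definition algebraic_cpo :: "('b::preorder \<Rightarrow> 'a::omega_cpo) \<Rightarrow> ('a \<Rightarrow> nat \<Rightarrow> 'b) \<Rightarrow> bool" where
  "algebraic_cpo incl idl \<longleftrightarrow> compact_type TYPE('b) \<and> dense_via incl idl"

definition extension ::
  "('a \<Rightarrow> nat \<Rightarrow> 'b) \<Rightarrow> ('b \<Rightarrow> 'c::preorder) \<Rightarrow> 'a \<Rightarrow> 'c" where
  "extension idl f a = (SOME c. is_sup (\<lambda>i. f (idl a i)) c)"

end

theory Submission
  imports Defs
begin

text \<open>
  Continuity of \<open>idl\<close> holds coordinatewise, so \<open>idl (sup U) i\<close> is the supremum of the directed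
  sequence \<open>n \<mapsto> idl (U n) i\<close> in the basis. By compactness this supremum is attained at some
  \<open>n\<close>, whence \<open>f (idl (sup U) i)\<close> lies below the value of the extension at \<open>U n\<close>.
\<close>

lemma is_sup_upper: "is_sup U s \<Longrightarrow> U i \<le> s" for s :: "'a::preorder"
  by (simp add: is_sup_def)

lemma is_sup_least: "is_sup U s \<Longrightarrow> (\<And>i. U i \<le> u) \<Longrightarrow> s \<le> u" for s :: "'a::preorder"
  by (simp add: is_sup_def)

lemma omega_chain_imp_directed: "omega_chain U \<Longrightarrow> directed U" for U :: "nat \<Rightarrow> 'a::preorder"
  unfolding omega_chain_def directed_def by (metis max.cobounded1 max.cobounded2)

text \<open>Apply continuity to the sequence x, y, y, ...: it is directed with supremum
  \<open>y\<close>, so \<open>h y\<close> bounds its image, whose term at index 0 is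
  \<open>h x\<close>.\<close>

lemma continuous_imp_mono:
  assumes "continuous h" and "x \<le> y"
  shows "h x \<le> h y"
proof -
  define U where "U = (\<lambda>n::nat. if n = 0 then x else y)"
  have "U i \<le> U 1" for i
    using assms(2) by (simp add: U_def)
  then have "directed U"
    unfolding directed_def by blast
  moreover have "is_sup U y"
    unfolding is_sup_def
  proof (intro conjI allI impI)
    show "U i \<le> y" for i
      using assms(2) by (simp add: U_def)
    show "y \<le> u" if "\<forall>i. U i \<le> u" for u
      using that[rule_format, of 1] by (simp add: U_def)
  qed
  ultimately have "is_sup (h \<circ> U) (h y)"
    using assms(1) unfolding continuous_def by blast
  from is_sup_upper[OF this, of 0] show ?thesis
    by (simp add: U_def)
qed

lemma directed_image:
  fixes U :: "nat \<Rightarrow> 'a::preorder" and h :: "'a \<Rightarrow> 'b::preorder"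
  assumes "directed U" and "\<And>x y. x \<le> y \<Longrightarrow> h x \<le> h y"
  shows "directed (\<lambda>n. h (U n))"
  using assms unfolding directed_def by blast

text \<open>Overwriting \<open>v\<close> at \<open>i\<close> with a bound \<open>u\<close> of the
  i-th coordinates gives an upper bound of all of \<open>V\<close>, since \<open>v\<close> already
  dominates the other coordinates. Leastness of \<open>v\<close>, read at \<open>i\<close>, then
  gives the claim.\<close>

lemma is_sup_coordinate:
  fixes V :: "nat \<Rightarrow> 'i \<Rightarrow> 'b::preorder"
  assumes "is_sup V v"
  shows "is_sup (\<lambda>n. V n i) (v i)"
  unfolding is_sup_def
proof (intro conjI allI impI)
  show "V n i \<le> v i" for n
    using is_sup_upper[OF assms] by (rule le_funD)
  fix u assume u: "\<forall>n. V n i \<le> u"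
  have "V n \<le> v(i := u)" for n
    using u is_sup_upper[OF assms, of n] by (simp add: le_fun_def)
  then have "v \<le> v(i := u)"
    by (rule is_sup_least[OF assms])
  from le_funD[OF this, of i] show "v i \<le> u"
    by simp
qed

text \<open>The choice in \<open>extension\<close> picks a genuine supremum: \<open>f\<close> maps
  the chain \<open>idl a\<close> to a directed sequence, which has a supremum in a dcpo. Later steps
  use \<open>extension\<close> only through this fact.\<close>

lemma is_sup_extension:
  fixes f :: "'b::preorder \<Rightarrow> 'c::dcpo"
  assumes "omega_chain (idl a)" and "monotone (\<le>) (\<le>) f"
  shows "is_sup (\<lambda>i. f (idl a i)) (extension idl f a)"
proof -
  have "directed (\<lambda>i. f (idl a i))"
    using omega_chain_imp_directed[OF assms(1)] monotoneD[OF assms(2)] by (rule directed_image)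
  then show ?thesis
    unfolding extension_def by (rule someI_ex[OF directed_has_sup])
qed

theorem mainTheorem13:
  fixes incl :: "'b::preorder \<Rightarrow> 'a::omega_cpo"
    and idl :: "'a \<Rightarrow> nat \<Rightarrow> 'b"
    and f :: "'b \<Rightarrow> 'c::dcpo"
  assumes "algebraic_cpo incl idl"
    and "monotone (\<le>) (\<le>) f"
  shows "continuous (extension idl f)"
proof -
  have compact: "compact_elem b" for b :: 'b
    using assms(1) by (simp add: algebraic_cpo_def compact_type_def)
  have idl: "continuous idl" and chain: "omega_chain (idl a)" for a
    using assms(1) by (simp_all add: algebraic_cpo_def dense_via_def)
  have idl_mono: "idl x i \<le> idl y i" if "x \<le> y" for x y i
    using continuous_imp_mono[OF idl that] by (rule le_funD)
  note ext = is_sup_extension[of idl, OF chain assms(2)]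
  \<comment> \<open>Monotonicity supplies the upper-bound half of continuity; compactness enters
    only in the leastness half.\<close>
  have ext_mono: "extension idl f x \<le> extension idl f y" if "x \<le> y" for x y
  proof (rule is_sup_least[OF ext])
    fix i
    have "f (idl x i) \<le> f (idl y i)"
      by (rule monotoneD[OF assms(2) idl_mono[OF that]])
    also have "\<dots> \<le> extension idl f y"
      by (rule is_sup_upper[OF ext])
    finally show "f (idl x i) \<le> extension idl f y" .
  qed
  have "is_sup (extension idl f \<circ> U) (extension idl f s)"
    if U: "directed U" "is_sup U s" for U s
    unfolding is_sup_def
  proof (intro conjI allI impI)
    show "(extension idl f \<circ> U) n \<le> extension idl f s" for n
      using ext_mono[OF is_sup_upper[OF U(2)]] by simp
    fix u assume u: "\<forall>n. (extension idl f \<circ> U) n \<le> u"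
    show "extension idl f s \<le> u"
    \<comment> \<open>The value at \<open>s\<close> is itself a supremum over \<open>i\<close>, so
      it suffices to bound \<open>f (idl s i)\<close> by \<open>u\<close> for each fixed
      \<open>i\<close>.\<close>
    proof (rule is_sup_least[OF ext])
      fix i
      have "is_sup (idl \<circ> U) (idl s)"
        using idl U unfolding continuous_def by blast
      then have "is_sup (\<lambda>n. idl (U n) i) (idl s i)"
        using is_sup_coordinate[of "idl \<circ> U"] by simp
      moreover have "directed (\<lambda>n. idl (U n) i)"
        using U(1) idl_mono by (rule directed_image)
      \<comment> \<open>The index \<open>n\<close> may vary with \<open>i\<close>; this is harmless,
        because \<open>u\<close> bounds the extension along all of \<open>U\<close>.\<close>
      ultimately obtain n where "idl s i \<le> idl (U n) i"
        using compact unfolding compact_elem_def order_equiv_def by blast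
      then have "f (idl s i) \<le> f (idl (U n) i)"
        by (rule monotoneD[OF assms(2)])
      also have "\<dots> \<le> extension idl f (U n)"
        by (rule is_sup_upper[OF ext])
      also have "\<dots> \<le> u"
        using u by simp
      finally show "f (idl s i) \<le> u" .
    qed
  qed
  then show ?thesis
    unfolding continuous_def by blast
qed

end
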